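(* Let $x,y,z>0$ be real numbers with $xyz=1$. Then all six of the following inequalities hold: $$\frac{1}{x^2-x+1}+\frac{1}{y^2-y+1}+\frac{1}{z^2-z+1}\le 3,$$ $$\frac{x}{x^2-x+1}+\frac{y}{y^2-y+1}+\frac{z}{z^2-z+1}\le 3,$$ $$\frac{x-1}{x^2+x+1}+\frac{y-1}{y^2+y+1}+\frac{z-1}{z^2+z+1}\le 0,$$ $$\frac{1}{x^2+x+1}+\frac{1}{y^2+y+1}+\frac{1}{z^2+z+1}\ge 1,$$ $$\frac{x}{x^2+x+1}+\frac{y}{y^2+y+1}+\frac{z}{z^2+z+1}\le 1,$$ $$\frac{x+1}{x^2+x+1}+\frac{y+1}{y^2+y+1}+\frac{z+1}{z^2+z+1}\le 2.$$ *)

theory Defs imports Complex_Main begin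

end

theory Submission imports Defs begin

text \<open>
  Everything follows from the fourth inequality,
  \<open>\<Sum> 1/(x\<^sup>2 + x + 1) \<ge> 1\<close>, which after clearing denominators and using \<open>xyz = 1\<close>
  is just \<open>x\<^sup>2 + y\<^sup>2 + z\<^sup>2 \<ge> xy + yz + zx\<close>.

  The constraint is invariant under \<open>t \<mapsto> 1/t\<close>, which turns \<open>1/(t\<^sup>2 + t + 1)\<close> into
  \<open>t\<^sup>2/(t\<^sup>2 + t + 1)\<close>, that is, into \<open>1 - (t + 1)/(t\<^sup>2 + t + 1)\<close>. This gives the sixth
  inequality. For each variable the three fractions with numerators \<open>1\<close>, \<open>t\<close>, \<open>t\<^sup>2\<close> add up
  to \<open>1\<close>, so lower bounds for the outer two give the fifth inequality; the
  third one is the fifth minus the fourth.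

  The two inequalities with denominators \<open>t\<^sup>2 - t + 1\<close> reduce to these by bounds in one
  variable, with equality at \<open>t = 1\<close>:
  \<open>t/(t\<^sup>2 - t + 1) \<le> 3 \<cdot> t/(t\<^sup>2 + t + 1)\<close>, to be combined with the fifth, and
  \<open>1/(t\<^sup>2 - t + 1) \<le> 3/2 \<cdot> (s + 1)/(s\<^sup>2 + s + 1)\<close> for \<open>s = t\<^sup>2\<close>, to be combined with the
  sixth for the squares of the variables, whose product is again \<open>1\<close>.
\<close>

lemma quadratic_plus_pos: "t\<^sup>2 + t + 1 > 0" for t :: real
proof -
  have "t\<^sup>2 + t + 1 = (t + 1/2)\<^sup>2 + 3/4" by (simp add: power2_eq_square algebra_simps)
  then show ?thesis by (simp add: add_nonneg_pos)
qed

lemma quadratic_minus_pos: "t\<^sup>2 - t + 1 > 0" for t :: real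
  using quadratic_plus_pos[of "- t"] by simp

text \<open>
  Up to multiples of \<open>xyz - 1\<close>, the sum of the pairwise products of the denominators exceeds
  the product of all three by \<open>x\<^sup>2 + y\<^sup>2 + z\<^sup>2 - xy - yz - zx\<close>, half a sum of squares.
\<close>

lemma sum_inverse_quadratic_ge_1:
  fixes x y z :: real
  assumes "x * y * z = 1"
  shows "1 / (x\<^sup>2 + x + 1) + 1 / (y\<^sup>2 + y + 1) + 1 / (z\<^sup>2 + z + 1) \<ge> 1"
proof -
  define A B C where ABC: "A = x\<^sup>2 + x + 1" "B = y\<^sup>2 + y + 1" "C = z\<^sup>2 + z + 1"
  have pos: "A > 0" "B > 0" "C > 0"
    unfolding ABC by (rule quadratic_plus_pos)+
  have "2 * (B * C + A * C + A * B - A * B * C) = (x - y)\<^sup>2 + (y - z)\<^sup>2 + (z - x)\<^sup>2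
      + 2 * (1 - x * y * z) * (2 + x * y * z + (x + y + z) + (x * y + y * z + z * x))"
    unfolding ABC by (simp add: power2_eq_square algebra_simps)
  then have "2 * (B * C + A * C + A * B - A * B * C) = (x - y)\<^sup>2 + (y - z)\<^sup>2 + (z - x)\<^sup>2"
    by (simp add: assms)
  then have "0 \<le> 2 * (B * C + A * C + A * B - A * B * C)"
    by (simp only:) (intro add_nonneg_nonneg zero_le_power2)
  then have "A * B * C \<le> B * C + A * C + A * B"
    by simp
  moreover have "1 / A + 1 / B + 1 / C = (B * C + A * C + A * B) / (A * B * C)"
    using pos by (simp add: field_simps)
  ultimately show ?thesis
    using pos by (simp add: ABC)
qed

text \<open>This is the previous lemma for the reciprocals of the variables.\<close>

lemma sum_succ_over_quadratic_le_2:
  fixes x y z :: real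
  assumes "x * y * z = 1"
  shows "(x + 1) / (x\<^sup>2 + x + 1) + (y + 1) / (y\<^sup>2 + y + 1) + (z + 1) / (z\<^sup>2 + z + 1) \<le> 2"
proof -
  have nz: "x \<noteq> 0" "y \<noteq> 0" "z \<noteq> 0" using assms by auto
  have recip: "1 / ((1/t)\<^sup>2 + 1/t + 1) = 1 - (t + 1) / (t\<^sup>2 + t + 1)" if "t \<noteq> 0" for t :: real
  proof -
    have "(1/t)\<^sup>2 + 1/t + 1 = (t\<^sup>2 + t + 1) / t\<^sup>2"
      using that by (simp add: field_simps power2_eq_square)
    then show ?thesis
      using quadratic_plus_pos[of t] by (simp add: diff_divide_eq_iff)
  qed
  have "(1/x) * (1/y) * (1/z) = 1" using assms by simp
  from sum_inverse_quadratic_ge_1[OF this] show ?thesis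
    by (simp only: recip nz not_False_eq_True)
qed

lemma sum_over_quadratic_le_1:
  fixes x y z :: real
  assumes "x * y * z = 1"
  shows "x / (x\<^sup>2 + x + 1) + y / (y\<^sup>2 + y + 1) + z / (z\<^sup>2 + z + 1) \<le> 1"
  using sum_succ_over_quadratic_le_2[OF assms] sum_inverse_quadratic_ge_1[OF assms]
  by (simp add: add_divide_distrib)

lemma over_quadratic_minus_le:
  fixes t :: real
  assumes "t > 0"
  shows "t / (t\<^sup>2 - t + 1) \<le> 3 * (t / (t\<^sup>2 + t + 1))"
proof -
  have "0 \<le> 2 * (t - 1)\<^sup>2" by simp
  then have "t\<^sup>2 + t + 1 \<le> 3 * (t\<^sup>2 - t + 1)"
    by (simp add: power2_eq_square algebra_simps)
  then have "1 / (t\<^sup>2 - t + 1) \<le> 3 / (t\<^sup>2 + t + 1)"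
    using quadratic_minus_pos[of t] quadratic_plus_pos[of t] by (simp add: field_simps)
  then have "t * (1 / (t\<^sup>2 - t + 1)) \<le> t * (3 / (t\<^sup>2 + t + 1))"
    using assms by (intro mult_left_mono) auto
  then show ?thesis by (simp add: mult.commute)
qed

text \<open>
  The factorisation \<open>t\<^sup>4 + t\<^sup>2 + 1 = (t\<^sup>2 + t + 1)(t\<^sup>2 - t + 1)\<close> reduces the claim to
  \<open>2 (t\<^sup>2 + t + 1) \<le> 3 (t\<^sup>2 + 1)\<close>, that is, \<open>(t - 1)\<^sup>2 \<ge> 0\<close>.
\<close>

lemma inverse_quadratic_minus_le:
  fixes t :: real
  shows "1 / (t\<^sup>2 - t + 1) \<le> 3/2 * ((t\<^sup>2 + 1) / ((t\<^sup>2)\<^sup>2 + t\<^sup>2 + 1))"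
proof -
  have factor: "(t\<^sup>2)\<^sup>2 + t\<^sup>2 + 1 = (t\<^sup>2 + t + 1) * (t\<^sup>2 - t + 1)" by algebra
  have "0 \<le> (t - 1)\<^sup>2" by simp
  then have le: "t\<^sup>2 + t + 1 \<le> 3/2 * (t\<^sup>2 + 1)"
    by (simp add: power2_eq_square algebra_simps)
  have "1 / (t\<^sup>2 - t + 1) = (t\<^sup>2 + t + 1) / ((t\<^sup>2)\<^sup>2 + t\<^sup>2 + 1)"
    unfolding factor using quadratic_plus_pos[of t] by simp
  also have "\<dots> \<le> (3/2 * (t\<^sup>2 + 1)) / ((t\<^sup>2)\<^sup>2 + t\<^sup>2 + 1)"
    using le quadratic_plus_pos[of "t\<^sup>2"] by (intro divide_right_mono) auto
  finally show ?thesis by simp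
qed

theorem mainTheorem2:
  fixes x y z :: real
  assumes "x > 0" and "y > 0" and "z > 0"
    and "x * y * z = 1"
  shows "1 / (x^2 - x + 1) + 1 / (y^2 - y + 1) + 1 / (z^2 - z + 1) \<le> 3
    \<and> x / (x^2 - x + 1) + y / (y^2 - y + 1) + z / (z^2 - z + 1) \<le> 3
    \<and> (x - 1) / (x^2 + x + 1) + (y - 1) / (y^2 + y + 1) + (z - 1) / (z^2 + z + 1) \<le> 0
    \<and> 1 / (x^2 + x + 1) + 1 / (y^2 + y + 1) + 1 / (z^2 + z + 1) \<ge> 1
    \<and> x / (x^2 + x + 1) + y / (y^2 + y + 1) + z / (z^2 + z + 1) \<le> 1
    \<and> (x + 1) / (x^2 + x + 1) + (y + 1) / (y^2 + y + 1) + (z + 1) / (z^2 + z + 1) \<le> 2"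
proof -
  have squares: "x\<^sup>2 * y\<^sup>2 * z\<^sup>2 = 1"
    using assms(4) by (simp flip: power_mult_distrib)
  have "1 / (x^2 - x + 1) + 1 / (y^2 - y + 1) + 1 / (z^2 - z + 1) \<le> 3"
    using sum_succ_over_quadratic_le_2[OF squares] inverse_quadratic_minus_le[of x]
      inverse_quadratic_minus_le[of y] inverse_quadratic_minus_le[of z]
    by linarith
  moreover have "x / (x^2 - x + 1) + y / (y^2 - y + 1) + z / (z^2 - z + 1) \<le> 3"
    using sum_over_quadratic_le_1[OF assms(4)] over_quadratic_minus_le[OF assms(1)]
      over_quadratic_minus_le[OF assms(2)] over_quadratic_minus_le[OF assms(3)]
    by linarith
  moreover have "(x - 1) / (x^2 + x + 1) + (y - 1) / (y^2 + y + 1) + (z - 1) / (z^2 + z + 1) \<le> 0"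
    using sum_over_quadratic_le_1[OF assms(4)] sum_inverse_quadratic_ge_1[OF assms(4)]
    by (simp add: diff_divide_distrib)
  ultimately show ?thesis
    using sum_inverse_quadratic_ge_1[OF assms(4)] sum_over_quadratic_le_1[OF assms(4)]
      sum_succ_over_quadratic_le_2[OF assms(4)]
    by blast
qed

end
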